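(* Let $\mathcal{I}=\mathcal{I}\langle a_i,\varphi_i\rangle_{i<\omega}$ be a gradually fragmented ideal. Then there exist a function $b\in\omega^\omega$ with $b>0$ and a $\mathbb{D}$-name $\dot h$ for a non-decreasing function in $\omega^\omega$ converging to infinity such that the two-step iteration $\mathbb{D}\ast\mathbb{Q}^{\dot h}_b$ destroys every $\mathcal{I}$-Rothberger gap of the ground model: for every $\mathcal{I}$-orthogonal pair $\langle\mathcal{A},\mathcal{B}\rangle$ in the ground model with $\mathcal{A}$ countable, the extension contains a set $C\subseteq\omega$ separating $\langle\mathcal{A},\mathcal{B}\rangle$ with respect to $\mathcal{I}$.
   Context: A submeasure on a finite set $a$ is a map $\varphi:\mathcal{P}(a)\to[0,+\infty)$ with $\varphi(\varnothing)=0$, monotone, finitely subadditive. For a partition $\{a_i\}$ of $\omega$ into nonempty finite sets and submeasures $\varphi_i$ on $\mathcal{P}(a_i)$, $\mathcal{I}\langle a_i,\varphi_i\rangle_{i<\omega}=\{x\subseteq\omega: \{\varphi_i(x\cap a_i)\}_{i<\omega}\text{ bounded}\}$; it is gradually fragmented if for every $k<\omega$ there is $m<\omega$ such that for every $l<\omega$, for all but finitely many $i$, for every $B\subseteq\mathcal{P}(a_i)$ with $|B|\leq l$ and $\varphi_i(b)\leq k$ for $b\in B$, $\varphi_i(\bigcup B)\leq m$. A pair $\langle\mathcal{A},\mathcal{B}\rangle$ of families of subsets of $\omega$ is $\mathcal{I}$-orthogonal if $A\cap B\in\mathcal{I}$ for all $A\in\mathcal{A},B\in\mathcal{B}$; $C$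 separates it if $A\cap C\in\mathcal{I}$ for all $A\in\mathcal{A}$ and $B\smallsetminus C\in\mathcal{I}$ for all $B\in\mathcal{B}$. $\mathbb{D}$ is Hechler forcing: conditions $(s,f)$ with $s\in\omega^{<\omega}$, $f\in\omega^\omega$, $s\subseteq f$, ordered by $(t,g)\leq(s,f)$ iff $s\subseteq t$ and $f\leq g$ pointwise. For $b\in\omega^\omega$ with $b>0$ (identify $b(i)$ with $\{0,\dots,b(i)-1\}$) and non-decreasing $h\in\omega^\omega$, let $\mathbb{R}_b=\prod_{i<\omega}b(i)$, $S_n(b,h)=\prod_{i<n}[b(i)]^{\leq h(i)}$, $S_{<\omega}(b,h)=\bigcup_n S_n(b,h)$, and $\mathbb{Q}^h_b=\{(s,F): s\in S_{<\omega}(b,h),\ F\subseteq\mathbb{R}_b,\ |F|\leq h(|s|)\}$ ordered by $(s',F')\leq(s,F)$ iff $s\subseteq s'$, $F\subseteq F'$ and $\{x(i):x\in F\}\subseteq s'(i)$ for all $i\in[|s|,|s'|)$. In $\mathbb{D}\ast\mathbb{Q}^{\dot h}_b$, the second factor is $\mathbb{Q}^h_b$ as computed in the $\mathbb{D}$-extension with $h$ the interpretation of $\dot h$. *)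

theory Defs
  imports Complex_Main "HOL-Library.Countable_Set" "HOL-Library.Disjoint_Sets"
    "HOL-Library.Sublist"
begin

section \<open>Gradually fragmented ideals\<close>

definition finite_partition :: "(nat \<Rightarrow> nat set) \<Rightarrow> bool" where
  "finite_partition a \<longleftrightarrow>
     (\<forall>i. finite (a i) \<and> a i \<noteq> {}) \<and> disjoint_family a \<and> (\<Union>i. a i) = UNIV"

definition submeasure_on :: "nat set \<Rightarrow> (nat set \<Rightarrow> real) \<Rightarrow> bool" where
  "submeasure_on u \<mu> \<longleftrightarrow>
     \<mu> {} = 0 \<and>
     (\<forall>x. x \<subseteq> u \<longrightarrow> 0 \<le> \<mu> x) \<and>
     (\<forall>x y. x \<subseteq> y \<and> y \<subseteq> u \<longrightarrow> \<mu> x \<le> \<mu> y) \<and>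
     (\<forall>x y. x \<subseteq> u \<and> y \<subseteq> u \<longrightarrow> \<mu> (x \<union> y) \<le> \<mu> x + \<mu> y)"

definition frag_ideal :: "(nat \<Rightarrow> nat set) \<Rightarrow> (nat \<Rightarrow> nat set \<Rightarrow> real) \<Rightarrow> nat set set" where
  "frag_ideal a \<phi> = {x. bdd_above (range (\<lambda>i. \<phi> i (x \<inter> a i)))}"

definition gradually_fragmented :: "(nat \<Rightarrow> nat set) \<Rightarrow> (nat \<Rightarrow> nat set \<Rightarrow> real) \<Rightarrow> bool" where
  "gradually_fragmented a \<phi> \<longleftrightarrow>
     (\<forall>k::nat. \<exists>m::nat. \<forall>l::nat. \<forall>\<^sub>\<infinity>i.
        \<forall>B. B \<subseteq> Pow (a i) \<and> card B \<le> l \<and> (\<forall>x\<in>B. \<phi> i x \<le> real k)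
          \<longrightarrow> \<phi> i (\<Union>B) \<le> real m)"

definition orthogonal_wrt :: "nat set set \<Rightarrow> nat set set \<Rightarrow> nat set set \<Rightarrow> bool" where
  "orthogonal_wrt I \<A> \<B> \<longleftrightarrow> (\<forall>A\<in>\<A>. \<forall>B\<in>\<B>. A \<inter> B \<in> I)"


section \<open>Forcing\<close>

text \<open>
  The ground model is the ambient universe of HOL. A sentence about the extension is identified
  with the predicate \<open>p \<mapsto> (p forces it)\<close> on conditions, and the connectives and quantifiers
  below are the clauses of the recursive definition of the forcing relation. Smaller conditions
  are stronger.
\<close>

record 'p forcing =
  conds :: "'p set"
  le :: "'p \<Rightarrow> 'p \<Rightarrow> bool"

type_synonym 'p sentence = "'p \<Rightarrow> bool"

definition dense_below :: "'p forcing \<Rightarrow> 'p \<Rightarrow> 'p set \<Rightarrow> bool" where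
  "dense_below P p E \<longleftrightarrow>
     (\<forall>q\<in>conds P. le P q p \<longrightarrow> (\<exists>r\<in>conds P. le P r q \<and> r \<in> E))"

text \<open>A statement about ground model objects that is absolute between ground model and
  extension.\<close>

definition f_abs :: "bool \<Rightarrow> 'p sentence" where
  "f_abs c = (\<lambda>p. c)"

definition f_not :: "'p forcing \<Rightarrow> 'p sentence \<Rightarrow> 'p sentence" where
  "f_not P \<alpha> = (\<lambda>p. \<forall>q\<in>conds P. le P q p \<longrightarrow> \<not> \<alpha> q)"

definition f_and :: "'p sentence \<Rightarrow> 'p sentence \<Rightarrow> 'p sentence" where
  "f_and \<alpha> \<beta> = (\<lambda>p. \<alpha> p \<and> \<beta> p)"

definition f_imp :: "'p forcing \<Rightarrow> 'p sentence \<Rightarrow> 'p sentence \<Rightarrow> 'p sentence" where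
  "f_imp P \<alpha> \<beta> = (\<lambda>p. \<forall>q\<in>conds P. le P q p \<longrightarrow> \<alpha> q \<longrightarrow> \<beta> q)"

definition f_iff :: "'p forcing \<Rightarrow> 'p sentence \<Rightarrow> 'p sentence \<Rightarrow> 'p sentence" where
  "f_iff P \<alpha> \<beta> = f_and (f_imp P \<alpha> \<beta>) (f_imp P \<beta> \<alpha>)"

text \<open>The index set of a quantifier is either a set of names, or a ground model set, whose members
  are identified with their canonical names.\<close>

definition f_all :: "'x set \<Rightarrow> ('x \<Rightarrow> 'p sentence) \<Rightarrow> 'p sentence" where
  "f_all X \<Phi> = (\<lambda>p. \<forall>x\<in>X. \<Phi> x p)"

definition f_ex :: "'p forcing \<Rightarrow> 'x set \<Rightarrow> ('x \<Rightarrow> 'p sentence) \<Rightarrow> 'p sentence" where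
  "f_ex P X \<Phi> = (\<lambda>p. dense_below P p {q. \<exists>x\<in>X. \<Phi> x q})"

definition forced :: "'p forcing \<Rightarrow> 'p sentence \<Rightarrow> bool" where
  "forced P \<alpha> \<longleftrightarrow> (\<forall>p\<in>conds P. \<alpha> p)"


subsection \<open>Names\<close>

text \<open>
  Names are sets of pairs (name of an element, condition), as usual, but typed: \<open>names P X\<close> are the
  names whose first components come from \<open>X\<close>. Three instances are used. For a ground model set
  \<open>X\<close> (canonical names), these are the names for subsets of \<open>X\<close>. In particular, the members of
  \<open>real_names P\<close> are names for subsets of \<open>\<omega> \<times> \<omega>\<close>, hence among them for (graphs of) elements of
  \<open>\<omega>\<^sup>\<omega>\<close>. Finally, \<open>names P (real_names P)\<close> are names for sets of subsets of \<open>\<omega> \<times> \<omega>\<close>.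
\<close>

type_synonym ('x, 'p) name = "('x \<times> 'p) set"

type_synonym 'p real_name = "(nat \<times> nat, 'p) name"

definition names :: "'p forcing \<Rightarrow> 'x set \<Rightarrow> ('x, 'p) name set" where
  "names P X = Pow (X \<times> conds P)"

abbreviation real_names :: "'p forcing \<Rightarrow> 'p real_name set" where
  "real_names P \<equiv> names P UNIV"

definition f_mem :: "'p forcing \<Rightarrow> 'x \<Rightarrow> ('x, 'p) name \<Rightarrow> 'p sentence" where
  "f_mem P x \<tau> = (\<lambda>p. dense_below P p {q. \<exists>r. (x, r) \<in> \<tau> \<and> le P q r})"

definition f_eq :: "'p forcing \<Rightarrow> ('x, 'p) name \<Rightarrow> ('x, 'p) name \<Rightarrow> 'p sentence" where
  "f_eq P \<sigma> \<tau> = f_all UNIV (\<lambda>x. f_iff P (f_mem P x \<sigma>) (f_mem P x \<tau>))"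

definition f_mem_set :: "'p forcing \<Rightarrow> 'p real_name \<Rightarrow> ('p real_name, 'p) name \<Rightarrow> 'p sentence" where
  "f_mem_set P x F =
     (\<lambda>p. dense_below P p {q. \<exists>y r. (y, r) \<in> F \<and> le P q r \<and> f_eq P x y q})"

text \<open>An element of a ground model set is named by a name for its singleton: \<open>f_val P \<tau> x\<close> says
  \<open>\<tau> = {x}\<close>.\<close>

definition f_val :: "'p forcing \<Rightarrow> ('x, 'p) name \<Rightarrow> 'x \<Rightarrow> 'p sentence" where
  "f_val P \<tau> x = f_all UNIV (\<lambda>y. f_iff P (f_mem P y \<tau>) (f_abs (y = x)))"


subsection \<open>Functions in \<open>\<omega>\<^sup>\<omega>\<close>\<close>

definition f_fun :: "'p forcing \<Rightarrow> 'p real_name \<Rightarrow> 'p sentence" where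
  "f_fun P h = f_all UNIV (\<lambda>n. f_ex P UNIV (\<lambda>k. f_all UNIV (\<lambda>j.
     f_iff P (f_mem P (n, j) h) (f_abs (j = k)))))"

definition f_nondecreasing :: "'p forcing \<Rightarrow> 'p real_name \<Rightarrow> 'p sentence" where
  "f_nondecreasing P h = f_all {(i, j). i \<le> j} (\<lambda>(i, j). f_all UNIV (\<lambda>(k, l).
     f_imp P (f_and (f_mem P (i, k) h) (f_mem P (j, l) h)) (f_abs (k \<le> l))))"

definition f_to_infinity :: "'p forcing \<Rightarrow> 'p real_name \<Rightarrow> 'p sentence" where
  "f_to_infinity P h = f_all UNIV (\<lambda>N. f_ex P UNIV (\<lambda>n. f_all {n..} (\<lambda>i. f_all UNIV (\<lambda>k.
     f_imp P (f_mem P (i, k) h) (f_abs (N \<le> k))))))"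

text \<open>\<open>x\<close> belongs to the product of the sets \<open>{0, \<dots>, b(i) - 1}\<close> as computed in the extension.\<close>

definition f_in_R :: "'p forcing \<Rightarrow> (nat \<Rightarrow> nat) \<Rightarrow> 'p real_name \<Rightarrow> 'p sentence" where
  "f_in_R P b x = f_and (f_fun P x)
     (f_all UNIV (\<lambda>(i, k). f_imp P (f_mem P (i, k) x) (f_abs (k < b i))))"


section \<open>Hechler forcing\<close>

definition hechler :: "(nat list \<times> (nat \<Rightarrow> nat)) forcing" where
  "hechler = \<lparr>
     conds = {(s, f). \<forall>i<length s. s ! i = f i},
     le = (\<lambda>(t, g) (s, f). prefix s t \<and> (\<forall>n. f n \<le> g n)) \<rparr>"


section \<open>The slalom forcing as computed in an extension\<close>

text \<open>A finite sequence of finite sets of naturals is a ground model object; \<open>s\<close> has the \<open>i\<close>-th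
  entry \<open>s ! i\<close>.\<close>

definition f_in_S ::
  "'p forcing \<Rightarrow> (nat \<Rightarrow> nat) \<Rightarrow> 'p real_name \<Rightarrow> nat set list \<Rightarrow> 'p sentence" where
  "f_in_S P b h s = f_all {..<length s} (\<lambda>i. f_and (f_abs (s ! i \<subseteq> {..<b i}))
     (f_ex P UNIV (\<lambda>k. f_and (f_mem P (i, k) h) (f_abs (card (s ! i) \<le> k)))))"

text \<open>\<open>F = {x\<^sub>0, \<dots>, x\<^sub>m\<^sub>-\<^sub>1}\<close> for some \<open>m \<le> n\<close>. A finite sequence in the extension is given by a
  ground model list of names.\<close>

definition f_card_le :: "'p forcing \<Rightarrow> ('p real_name, 'p) name \<Rightarrow> nat \<Rightarrow> 'p sentence" where
  "f_card_le P F n = f_ex P {xs. length xs \<le> n \<and> set xs \<subseteq> real_names P} (\<lambda>xs.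
     f_all (real_names P) (\<lambda>x. f_iff P (f_mem_set P x F) (f_ex P (set xs) (\<lambda>y. f_eq P x y))))"

text \<open>A name for a pair \<open>(s, F)\<close> is a pair of names.\<close>

type_synonym 'p slalom_name = "(nat set list, 'p) name \<times> ('p real_name, 'p) name"

definition slalom_names :: "'p forcing \<Rightarrow> 'p slalom_name set" where
  "slalom_names P = names P UNIV \<times> names P (real_names P)"

definition f_in_Q ::
  "'p forcing \<Rightarrow> (nat \<Rightarrow> nat) \<Rightarrow> 'p real_name \<Rightarrow> 'p slalom_name \<Rightarrow> 'p sentence" where
  "f_in_Q P b h = (\<lambda>(\<sigma>, F). f_ex P UNIV (\<lambda>s.
     f_and (f_val P \<sigma> s)
    (f_and (f_in_S P b h s)
    (f_and (f_all (real_names P) (\<lambda>x. f_imp P (f_mem_set P x F) (f_in_R P b x)))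
           (f_ex P UNIV (\<lambda>k. f_and (f_mem P (length s, k) h) (f_card_le P F k)))))))"

definition f_le_Q :: "'p forcing \<Rightarrow> 'p slalom_name \<Rightarrow> 'p slalom_name \<Rightarrow> 'p sentence" where
  "f_le_Q P = (\<lambda>(\<sigma>', F') (\<sigma>, F). f_ex P UNIV (\<lambda>s'. f_ex P UNIV (\<lambda>s.
     f_and (f_val P \<sigma>' s')
    (f_and (f_val P \<sigma> s)
    (f_and (f_abs (prefix s s'))
    (f_and (f_all (real_names P) (\<lambda>x. f_imp P (f_mem_set P x F) (f_mem_set P x F')))
           (f_all {length s..<length s'} (\<lambda>i. f_all (real_names P) (\<lambda>x. f_all UNIV (\<lambda>k.
              f_imp P (f_and (f_mem_set P x F) (f_mem P (i, k) x)) (f_abs (k \<in> s' ! i))))))))))))"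


section \<open>Two-step iteration\<close>

text \<open>The second factor is given by a set \<open>N\<close> of \<open>P\<close>-names for its potential elements and by the
  formulas defining its underlying set and its order in the \<open>P\<close>-extension.\<close>

definition two_step ::
  "'p forcing \<Rightarrow> 'q set \<Rightarrow> ('q \<Rightarrow> 'p sentence) \<Rightarrow> ('q \<Rightarrow> 'q \<Rightarrow> 'p sentence) \<Rightarrow> ('p \<times> 'q) forcing"
where
  "two_step P N in_Q le_Q = \<lparr>
     conds = {(p, q). p \<in> conds P \<and> q \<in> N \<and> in_Q q p},
     le = (\<lambda>(p', q') (p, q). le P p' p \<and> le_Q q' q p') \<rparr>"

abbreviation hechler_slalom where
  "hechler_slalom b h \<equiv>
     two_step hechler (slalom_names hechler) (f_in_Q hechler b h) (f_le_Q hechler)"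


section \<open>Separation in an extension\<close>

text \<open>
  \<open>X n\<close> is the sentence \<open>n \<in> X\<close> for a set \<open>X \<subseteq> \<omega>\<close> of the extension. Since \<open>a i\<close> is finite,
  \<open>X \<inter> a i\<close> is one of the ground model sets \<open>y \<subseteq> a i\<close>; and a sequence of nonnegative reals of
  the extension is bounded iff it is bounded by a natural number \<open>K\<close>.
\<close>

definition f_in_ideal ::
  "'p forcing \<Rightarrow> (nat \<Rightarrow> nat set) \<Rightarrow> (nat \<Rightarrow> nat set \<Rightarrow> real) \<Rightarrow> (nat \<Rightarrow> 'p sentence) \<Rightarrow> 'p sentence"
where
  "f_in_ideal P a \<phi> X = f_ex P UNIV (\<lambda>K::nat. f_all UNIV (\<lambda>i. f_ex P (Pow (a i)) (\<lambda>y.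
     f_and (f_all (a i) (\<lambda>n. f_iff P (X n) (f_abs (n \<in> y)))) (f_abs (\<phi> i y \<le> real K)))))"

definition f_separates ::
  "'p forcing \<Rightarrow> (nat \<Rightarrow> nat set) \<Rightarrow> (nat \<Rightarrow> nat set \<Rightarrow> real) \<Rightarrow> nat set set \<Rightarrow> nat set set
     \<Rightarrow> (nat, 'p) name \<Rightarrow> 'p sentence" where
  "f_separates P a \<phi> \<A> \<B> C = f_and
     (f_all \<A> (\<lambda>A. f_in_ideal P a \<phi> (\<lambda>n. f_and (f_abs (n \<in> A)) (f_mem P n C))))
     (f_all \<B> (\<lambda>B. f_in_ideal P a \<phi> (\<lambda>n. f_and (f_abs (n \<in> B)) (f_not P (f_mem P n C)))))"

end

theory Submission
  imports Defs
begin

text \<open>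
  The generic slalom captures every ground model real of \<open>\<real>\<^sub>b\<close>, where \<open>b(i)\<close> codes the subsets of \<open>a i\<close>. Let
  \<open>A\<^sub>0, A\<^sub>1, \<dots>\<close> enumerate \<open>\<A>\<close>, let \<open>d\<close> be the Hechler real and \<open>S\<close> the generic slalom, and let
  \<open>C \<inter> a i\<close> be the union of those \<open>y \<subseteq> a i\<close> coded in \<open>S(i)\<close> with \<open>\<phi>\<^sub>i(y \<inter> A\<^sub>j) \<le> d(j)\<close> for all \<open>j \<le> i\<close>.
  Then \<open>C \<inter> A\<^sub>j \<inter> a i\<close> is a union of at most \<open>h(i)\<close> sets of submeasure at most \<open>d(j)\<close>, which gradual
  fragmentation bounds independently of \<open>i\<close> if \<open>h\<close> grows slowly enough; such an \<open>h\<close> exists already in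
  the ground model. For \<open>B \<in> \<B>\<close>, \<open>d\<close> dominates \<open>j \<mapsto> sup\<^sub>i \<phi>\<^sub>i(B \<inter> A\<^sub>j \<inter> a i)\<close> from some \<open>n\<close> on, so
  the pieces of \<open>B' = B - (A\<^sub>0 \<union> \<dots> \<union> A\<^sub>n\<^sub>-\<^sub>1)\<close> pass the test and are captured by \<open>S\<close> at almost all
  \<open>i\<close>, while \<open>B - B'\<close> belongs to the ideal by orthogonality.
\<close>

section \<open>Forcing over a preorder\<close>

text \<open>\<open>check P X\<close> is the canonical name of \<open>X\<close>, and \<open>fun_name P x\<close> that of the graph of \<open>x\<close>.\<close>

definition check :: "'p forcing \<Rightarrow> 'x set \<Rightarrow> ('x, 'p) name" where
  "check P X = X \<times> conds P"

definition fun_name :: "'p forcing \<Rightarrow> (nat \<Rightarrow> nat) \<Rightarrow> 'p real_name" where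
  "fun_name P x = check P (range (\<lambda>i. (i, x i)))"

text \<open>A \<open>sentence\<close> is an arbitrary predicate on conditions, so the two basic
  properties of a forcing relation are isolated here and in \<open>local_at_dense\<close>, to be
  derived from the shape of each formula.\<close>

definition persistent :: "'p forcing \<Rightarrow> 'p sentence \<Rightarrow> bool" where
  "persistent P \<alpha> \<longleftrightarrow> (\<forall>p q. le P q p \<longrightarrow> \<alpha> p \<longrightarrow> \<alpha> q)"

definition local_at_dense :: "'p forcing \<Rightarrow> 'p sentence \<Rightarrow> bool" where
  "local_at_dense P \<alpha> \<longleftrightarrow> (\<forall>p\<in>conds P. dense_below P p {q. \<alpha> q} \<longrightarrow> \<alpha> p)"

lemma check_in_names: "X \<subseteq> Y \<Longrightarrow> check P X \<in> names P Y"
  by (auto simp: check_def names_def)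

lemma fun_name_in_names: "fun_name P x \<in> real_names P"
  by (simp add: fun_name_def check_in_names)

lemma persistentD: "persistent P \<alpha> \<Longrightarrow> \<alpha> p \<Longrightarrow> le P q p \<Longrightarrow> \<alpha> q"
  by (auto simp: persistent_def)

lemma local_at_denseD:
  assumes "local_at_dense P \<alpha>" "p \<in> conds P"
    "\<And>q. q \<in> conds P \<Longrightarrow> le P q p \<Longrightarrow> \<exists>r\<in>conds P. le P r q \<and> \<alpha> r"
  shows "\<alpha> p"
  using assms by (auto simp: local_at_dense_def dense_below_def)

lemma f_and_iff: "f_and \<alpha> \<beta> p \<longleftrightarrow> \<alpha> p \<and> \<beta> p"
  by (simp add: f_and_def)

lemma f_andI: "\<alpha> p \<Longrightarrow> \<beta> p \<Longrightarrow> f_and \<alpha> \<beta> p"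
  by (simp add: f_and_def)

lemma f_abs_iff: "f_abs c p \<longleftrightarrow> c"
  by (simp add: f_abs_def)

lemma f_all_iff: "f_all X \<Phi> p \<longleftrightarrow> (\<forall>x\<in>X. \<Phi> x p)"
  by (simp add: f_all_def)

lemma f_allI: "(\<And>x. x \<in> X \<Longrightarrow> \<Phi> x p) \<Longrightarrow> f_all X \<Phi> p"
  by (simp add: f_all_def)

lemma f_imp_iff: "f_imp P \<alpha> \<beta> p \<longleftrightarrow> (\<forall>q\<in>conds P. le P q p \<longrightarrow> \<alpha> q \<longrightarrow> \<beta> q)"
  by (simp add: f_imp_def)

lemma f_iff_iff: "f_iff P \<alpha> \<beta> p \<longleftrightarrow> (\<forall>q\<in>conds P. le P q p \<longrightarrow> (\<alpha> q \<longleftrightarrow> \<beta> q))"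
  by (auto simp: f_iff_def f_and_def f_imp_def)

lemmas forces_simps = f_and_iff f_abs_iff f_all_iff f_imp_iff f_iff_iff

text \<open>Both axioms range over the whole type, which fits Hechler forcing. The order of the
  iteration can fail to be reflexive outside its conditions, hence the separate
  \<open>iter_refl\<close> and \<open>iter_trans\<close>.\<close>

locale preordered_forcing =
  fixes P :: "'p forcing"
  assumes le_refl: "le P p p"
    and le_trans: "le P p q \<Longrightarrow> le P q r \<Longrightarrow> le P p r"
begin

lemma dense_below_mono: "dense_below P p E \<Longrightarrow> le P q p \<Longrightarrow> dense_below P q E"
  unfolding dense_below_def using le_trans by blast

lemma dense_belowE:
  assumes "dense_below P p E" "p \<in> conds P"
  obtains q where "q \<in> conds P" "le P q p" "q \<in> E"
  using assms le_refl unfolding dense_below_def by blast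

lemma dense_below_local:
  assumes "\<And>q. q \<in> conds P \<Longrightarrow> le P q p \<Longrightarrow> \<exists>r\<in>conds P. le P r q \<and> dense_below P r E"
  shows "dense_below P p E"
  unfolding dense_below_def
proof (intro ballI impI)
  fix q assume "q \<in> conds P" "le P q p"
  then obtain r where r: "r \<in> conds P" "le P r q" "dense_below P r E" using assms by blast
  then obtain r' where "r' \<in> conds P" "le P r' r" "r' \<in> E" by (meson dense_belowE)
  then show "\<exists>r\<in>conds P. le P r q \<and> r \<in> E" using r le_trans by blast
qed

section \<open>Persistence and locality of formulas\<close>

lemma persistent_intros:
  "persistent P (f_abs c)"
  "persistent P (f_imp P \<alpha> \<beta>)"
  "persistent P (f_iff P \<alpha> \<beta>)"
  "persistent P \<alpha> \<Longrightarrow> persistent P \<beta> \<Longrightarrow> persistent P (f_and \<alpha> \<beta>)"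
  "(\<And>x. x \<in> X \<Longrightarrow> persistent P (\<Phi> x)) \<Longrightarrow> persistent P (f_all X \<Phi>)"
  "persistent P (f_ex P Y \<Psi>)"
  "persistent P (f_mem P z \<tau>)"
  "persistent P (f_mem_set P x F)"
  by (auto simp: persistent_def f_abs_iff f_imp_iff f_iff_iff f_and_iff f_all_iff f_ex_def f_mem_def
      f_mem_set_def intro: dense_below_mono le_trans)

lemma persistent_f_eq: "persistent P (f_eq P \<sigma> \<tau>)"
  unfolding f_eq_def by (intro persistent_intros)

lemma persistent_f_val: "persistent P (f_val P \<tau> x)"
  unfolding f_val_def by (intro persistent_intros)

lemma persistent_f_in_R: "persistent P (f_in_R P b x)"
  unfolding f_in_R_def f_fun_def
  by (auto intro!: persistent_intros split: prod.split)

lemma persistent_f_in_S: "persistent P (f_in_S P b h s)"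
  unfolding f_in_S_def by (auto intro!: persistent_intros)

lemma persistent_f_card_le: "persistent P (f_card_le P F n)"
  unfolding f_card_le_def by (intro persistent_intros)

lemma persistent_f_in_Q: "persistent P (f_in_Q P b h q)"
  unfolding f_in_Q_def by (cases q) (simp add: persistent_intros)

lemma persistent_f_le_Q: "persistent P (f_le_Q P q' q)"
  unfolding f_le_Q_def by (cases q; cases q') (simp add: persistent_intros)

lemmas persistent_rules = persistent_intros persistent_f_eq persistent_f_val persistent_f_in_R
  persistent_f_in_S persistent_f_card_le persistent_f_in_Q persistent_f_le_Q

lemma f_exI: "x \<in> X \<Longrightarrow> \<Phi> x p \<Longrightarrow> persistent P (\<Phi> x) \<Longrightarrow> f_ex P X \<Phi> p"
  unfolding f_ex_def dense_below_def persistent_def using le_refl by blast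

lemma f_exE:
  assumes "f_ex P X \<Phi> p" "p \<in> conds P"
  obtains q x where "q \<in> conds P" "le P q p" "x \<in> X" "\<Phi> x q"
  using assms unfolding f_ex_def by (auto elim: dense_belowE)

text \<open>For an implication, the premise is given at \<open>q\<close> while the implication is
  known only at densely many conditions; persistence carries the premise down to one of them. An
  existential formula is itself a density statement, so no assumption on its body enters.\<close>

lemma local_intros:
  "local_at_dense P (f_abs c)"
  "persistent P \<alpha> \<Longrightarrow> local_at_dense P \<beta> \<Longrightarrow> local_at_dense P (f_imp P \<alpha> \<beta>)"
  "local_at_dense P \<alpha> \<Longrightarrow> local_at_dense P \<beta> \<Longrightarrow> local_at_dense P (f_and \<alpha> \<beta>)"
  "(\<And>x. x \<in> X \<Longrightarrow> local_at_dense P (\<Phi> x)) \<Longrightarrow> local_at_dense P (f_all X \<Phi>)"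
  "local_at_dense P (f_ex P Y \<Psi>)"
proof -
  show "local_at_dense P (f_abs c)"
    unfolding local_at_dense_def f_abs_iff by (auto elim: dense_belowE)
  show "local_at_dense P (f_imp P \<alpha> \<beta>)" if "persistent P \<alpha>" "local_at_dense P \<beta>"
    unfolding local_at_dense_def f_imp_iff
  proof (intro ballI impI)
    fix p q assume d: "p \<in> conds P" "dense_below P p {q. \<forall>q'\<in>conds P. le P q' q \<longrightarrow> \<alpha> q' \<longrightarrow> \<beta> q'}"
      and q: "q \<in> conds P" "le P q p" "\<alpha> q"
    show "\<beta> q"
    proof (rule local_at_denseD[OF that(2) q(1)])
      fix r assume "r \<in> conds P" "le P r q"
      note r = this
      then obtain r' where r': "r' \<in> conds P" "le P r' r"
        "\<forall>q'\<in>conds P. le P q' r' \<longrightarrow> \<alpha> q' \<longrightarrow> \<beta> q'"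
        using d(2) le_trans[OF r(2) q(2)] unfolding dense_below_def by blast
      moreover have "\<alpha> r'" using persistentD[OF that(1) q(3)] le_trans[OF r'(2) r(2)] by blast
      ultimately show "\<exists>r'\<in>conds P. le P r' r \<and> \<beta> r'" using le_refl by blast
    qed
  qed
  show "local_at_dense P (f_and \<alpha> \<beta>)" if "local_at_dense P \<alpha>" "local_at_dense P \<beta>"
    using that unfolding local_at_dense_def f_and_iff dense_below_def by blast
  show "local_at_dense P (f_all X \<Phi>)" if "\<And>x. x \<in> X \<Longrightarrow> local_at_dense P (\<Phi> x)"
    using that unfolding local_at_dense_def f_all_iff dense_below_def by blast
  show "local_at_dense P (f_ex P Y \<Psi>)"
    unfolding local_at_dense_def f_ex_def
    by (intro ballI impI dense_below_local) (auto simp: dense_below_def)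
qed

section \<open>Canonical names\<close>

lemma f_mem_check: "p \<in> conds P \<Longrightarrow> f_mem P x (check P X) p \<longleftrightarrow> x \<in> X"
  unfolding f_mem_def check_def dense_below_def using le_refl by blast

lemma f_mem_fun_name: "p \<in> conds P \<Longrightarrow> f_mem P (i, k) (fun_name P x) p \<longleftrightarrow> k = x i"
  by (auto simp: fun_name_def f_mem_check)

lemma f_val_check: "f_val P (check P {x}) x p"
  by (simp add: f_val_def forces_simps f_mem_check)

lemma f_val_unique: "p \<in> conds P \<Longrightarrow> f_val P \<tau> x p \<Longrightarrow> f_val P \<tau> y p \<Longrightarrow> x = y"
  using le_refl by (auto simp: f_val_def forces_simps)

lemma f_eq_refl: "f_eq P x x p"
  by (simp add: f_eq_def forces_simps)

lemma f_eqD: "f_eq P x y p \<Longrightarrow> q \<in> conds P \<Longrightarrow> le P q p \<Longrightarrow> f_mem P z x q \<longleftrightarrow> f_mem P z y q"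
  by (simp add: f_eq_def forces_simps)

text \<open>For a canonical name, membership up to forced equality takes the existential form that
  \<open>f_card_le\<close> uses, so a set listed by \<open>xs\<close> can be replaced by
  \<open>check P (set xs)\<close>.\<close>

lemma f_mem_set_check: "f_mem_set P x (check P Y) p \<longleftrightarrow> f_ex P Y (f_eq P x) p"
  unfolding f_mem_set_def f_ex_def dense_below_def check_def using le_refl by blast

lemma f_mem_set_checkI: "x \<in> Y \<Longrightarrow> f_mem_set P x (check P Y) p"
  unfolding f_mem_set_check by (rule f_exI) (auto simp: f_eq_refl persistent_f_eq)

lemma f_mem_set_check_mono:
  "Y \<subseteq> Z \<Longrightarrow> f_mem_set P x (check P Y) p \<Longrightarrow> f_mem_set P x (check P Z) p"
  unfolding f_mem_set_check f_ex_def dense_below_def by blast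

section \<open>Names for reals\<close>

lemma f_fun_fun_name: "f_fun P (fun_name P x) p"
  unfolding f_fun_def
proof (rule f_allI)
  fix n
  show "f_ex P UNIV (\<lambda>k. f_all UNIV (\<lambda>j.
      f_iff P (f_mem P (n, j) (fun_name P x)) (f_abs (j = k)))) p"
    by (intro f_exI[of "x n"] persistent_intros) (auto simp: forces_simps f_mem_fun_name)
qed

lemma f_in_R_value:
  assumes "f_in_R P b x p" "q \<in> conds P" "le P q p"
  obtains r k where "r \<in> conds P" "le P r q"
    "\<forall>j. \<forall>r'\<in>conds P. le P r' r \<longrightarrow> (f_mem P (n, j) x r' \<longleftrightarrow> j = k)"
proof -
  have "f_ex P UNIV (\<lambda>k. f_all UNIV (\<lambda>j. f_iff P (f_mem P (n, j) x) (f_abs (j = k)))) p"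
    using assms(1) unfolding f_in_R_def f_fun_def f_and_iff by (simp add: f_all_def)
  from f_exE[OF persistentD[OF persistent_intros(6) this assms(3)] assms(2)] show ?thesis
    using that by (auto simp: forces_simps)
qed

lemma f_in_R_cong:
  assumes "f_eq P x y p" "f_in_R P b y p"
  shows "f_in_R P b x p"
proof -
  have "\<forall>n. dense_below P p {q. \<exists>k. \<forall>j. \<forall>r\<in>conds P. le P r q \<longrightarrow> f_mem P (n, j) x r = (j = k)}"
    unfolding dense_below_def
  proof (intro allI ballI impI)
    fix n q assume q: "q \<in> conds P" "le P q p"
    then obtain r k where "r \<in> conds P" "le P r q"
      "\<forall>j. \<forall>r'\<in>conds P. le P r' r \<longrightarrow> f_mem P (n, j) y r' = (j = k)"
      by (rule f_in_R_value[OF assms(2)]) (rule that)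
    moreover have "f_mem P (n, j) x r' \<longleftrightarrow> f_mem P (n, j) y r'" if "r' \<in> conds P" "le P r' r" for r' j
      using f_eqD[OF assms(1) that(1)] that q le_trans calculation(2) by blast
    ultimately show "\<exists>r\<in>conds P. le P r q \<and>
        r \<in> {q. \<exists>k. \<forall>j. \<forall>r\<in>conds P. le P r q \<longrightarrow> f_mem P (n, j) x r = (j = k)}"
      by (intro bexI[of _ r]) auto
  qed
  then show ?thesis
    using assms(2) f_eqD[OF assms(1)] by (auto simp: f_in_R_def f_fun_def forces_simps f_ex_def)
qed

lemma local_f_in_R: "local_at_dense P (f_in_R P b x)"
  unfolding f_in_R_def f_fun_def
  by (auto intro!: local_intros persistent_intros split: prod.split)

text \<open>Which \<open>y\<close> equals \<open>x\<close> is settled only at densely many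
  conditions and may vary between them; \<open>local_f_in_R\<close> glues the local answers.\<close>

lemma f_in_R_if_mem_check:
  assumes "\<And>y. y \<in> Y \<Longrightarrow> f_in_R P b y p" "q \<in> conds P" "le P q p" "f_mem_set P x (check P Y) q"
  shows "f_in_R P b x q"
proof (rule local_at_denseD[OF local_f_in_R assms(2)])
  fix r assume r: "r \<in> conds P" "le P r q"
  with assms(4) obtain r' y where "r' \<in> conds P" "le P r' r" "y \<in> Y" "f_eq P x y r'"
    unfolding f_mem_set_check f_ex_def dense_below_def by auto
  moreover from this have "f_in_R P b y r'"
    using assms(1,3) r le_trans persistentD[OF persistent_f_in_R] by blast
  ultimately show "\<exists>r'\<in>conds P. le P r' r \<and> f_in_R P b x r'"
    using f_in_R_cong by blast
qed

lemma f_in_R_fun_name: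
  assumes "\<And>i. x i < b i"
  shows "f_in_R P b (fun_name P x) p"
  using assms f_fun_fun_name by (auto simp: f_in_R_def forces_simps f_mem_fun_name)

text \<open>One strengthening per name; earlier decisions survive because they speak of all stronger
  conditions. The decided values will form the next slalom entry.\<close>

lemma f_in_R_decide:
  assumes "p \<in> conds P" "\<And>x. x \<in> set xs \<Longrightarrow> f_in_R P b x p"
  obtains q v where "q \<in> conds P" "le P q p"
    "\<And>x r j. x \<in> set xs \<Longrightarrow> r \<in> conds P \<Longrightarrow> le P r q \<Longrightarrow> f_mem P (n, j) x r \<longleftrightarrow> j = v x"
proof -
  have "\<exists>q\<in>conds P. le P q p \<and>
     (\<exists>v. \<forall>x\<in>set xs. \<forall>r\<in>conds P. le P r q \<longrightarrow> (\<forall>j. f_mem P (n, j) x r \<longleftrightarrow> j = v x))"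
    using assms(2)
  proof (induction xs)
    case Nil
    then show ?case using assms(1) le_refl by auto
  next
    case (Cons x xs)
    then obtain q v where q: "q \<in> conds P" "le P q p"
      "\<forall>x\<in>set xs. \<forall>r\<in>conds P. le P r q \<longrightarrow> (\<forall>j. f_mem P (n, j) x r \<longleftrightarrow> j = v x)"
      by auto
    have "f_in_R P b x q" by (rule persistentD[OF persistent_f_in_R _ q(2)]) (simp add: Cons.prems)
    then obtain q' k where q': "q' \<in> conds P" "le P q' q"
      "\<forall>j. \<forall>r\<in>conds P. le P r q' \<longrightarrow> (f_mem P (n, j) x r \<longleftrightarrow> j = k)"
      by (rule f_in_R_value[OF _ q(1) le_refl]) (rule that)
    have "\<forall>y\<in>set (x # xs). \<forall>r\<in>conds P. le P r q' \<longrightarrow>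
        (\<forall>j. f_mem P (n, j) y r \<longleftrightarrow> j = (v(x := k)) y)"
      using q(3) q'(2,3) le_trans by auto
    then show ?case using q' q(2) le_trans by blast
  qed
  then show ?thesis using that by blast
qed

end

section \<open>Normal conditions in the iteration\<close>

locale slalom_iteration = preordered_forcing P for P :: "'p forcing" +
  fixes b h :: "nat \<Rightarrow> nat"
  assumes mono_h: "mono h"
begin

abbreviation h_name :: "'p real_name" where
  "h_name \<equiv> fun_name P h"

definition iter :: "('p \<times> 'p slalom_name) forcing" where
  "iter = two_step P (slalom_names P) (f_in_Q P b h_name) (f_le_Q P)"

text \<open>Together with \<open>cond\<close> this singles out the conditions whose finite sequence
  \<open>s\<close> is known and whose set of reals is listed by finitely many names. The reals
  themselves stay names, since they need not belong to the ground model.\<close>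

definition normal :: "'p \<Rightarrow> nat set list \<Rightarrow> 'p real_name list \<Rightarrow> bool" where
  "normal p s xs \<longleftrightarrow> p \<in> conds P \<and> (\<forall>i<length s. s ! i \<subseteq> {..<b i} \<and> card (s ! i) \<le> h i) \<and>
     length xs \<le> h (length s) \<and> set xs \<subseteq> real_names P \<and> (\<forall>x\<in>set xs. f_in_R P b x p)"

definition cond :: "'p \<Rightarrow> nat set list \<Rightarrow> 'p real_name list \<Rightarrow> 'p \<times> 'p slalom_name" where
  "cond p s xs = (p, check P {s}, check P (set xs))"

lemma iter_conds: "(p, \<sigma>, F) \<in> conds iter \<longleftrightarrow>
    p \<in> conds P \<and> (\<sigma>, F) \<in> slalom_names P \<and> f_in_Q P b h_name (\<sigma>, F) p"
  by (simp add: iter_def two_step_def)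

lemma iter_le: "le iter (p', q') (p, q) \<longleftrightarrow> le P p' p \<and> f_le_Q P q' q p'"
  by (simp add: iter_def two_step_def)

lemma h_name_forced:
  assumes "filterlim h at_top sequentially"
  shows "forced P (f_and (f_fun P h_name) (f_and (f_nondecreasing P h_name) (f_to_infinity P h_name)))"
proof -
  have "f_fun P h_name p" for p
    by (rule f_fun_fun_name)
  moreover have "f_nondecreasing P h_name p" for p
    using mono_h by (auto simp: f_nondecreasing_def forces_simps f_mem_fun_name monoD)
  moreover have "f_to_infinity P h_name p" for p
    unfolding f_to_infinity_def
  proof (rule f_allI)
    fix N
    obtain n where "\<forall>i\<ge>n. N \<le> h i"
      using assms by (auto simp: filterlim_at_top eventually_sequentially)
    then show "f_ex P UNIV (\<lambda>n. f_all {n..} (\<lambda>i. f_all UNIV (\<lambda>k.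
        f_imp P (f_mem P (i, k) h_name) (f_abs (N \<le> k))))) p"
      by (intro f_exI[of n] persistent_intros) (auto simp: forces_simps f_mem_fun_name)
  qed
  ultimately show ?thesis by (simp add: forced_def f_and_iff)
qed

section \<open>The order of the iteration\<close>

lemma f_le_QI:
  assumes "f_val P \<sigma>' s' p" "f_val P \<sigma> s p" "prefix s s'"
    "\<And>x q. x \<in> real_names P \<Longrightarrow> q \<in> conds P \<Longrightarrow> le P q p \<Longrightarrow> f_mem_set P x F q \<Longrightarrow> f_mem_set P x F' q"
    "\<And>x q i k. \<lbrakk>x \<in> real_names P; q \<in> conds P; le P q p; f_mem_set P x F q; f_mem P (i, k) x q;
        length s \<le> i; i < length s'\<rbrakk> \<Longrightarrow> k \<in> s' ! i"
  shows "f_le_Q P (\<sigma>', F') (\<sigma>, F) p"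
  unfolding f_le_Q_def prod.case
  by (intro f_exI[of s'] f_exI[of s] persistent_rules) (use assms in \<open>auto simp: forces_simps\<close>)

text \<open>Both sequences are hidden behind existential quantifiers, so they become available only
  after strengthening to some \<open>q\<close>.\<close>

lemma f_le_QE:
  assumes "f_le_Q P (\<sigma>', F') (\<sigma>, F) p" "p \<in> conds P"
  obtains q s' s where "q \<in> conds P" "le P q p" "f_val P \<sigma>' s' q" "f_val P \<sigma> s q" "prefix s s'"
    "\<forall>x\<in>real_names P. \<forall>r\<in>conds P. le P r q \<longrightarrow> f_mem_set P x F r \<longrightarrow> f_mem_set P x F' r"
    "\<forall>i\<in>{length s..<length s'}. \<forall>x\<in>real_names P. \<forall>k. \<forall>r\<in>conds P. le P r q \<longrightarrow>
       f_mem_set P x F r \<and> f_mem P (i, k) x r \<longrightarrow> k \<in> s' ! i"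
proof -
  from assms obtain q1 s' where 1: "q1 \<in> conds P" "le P q1 p"
    "f_ex P UNIV (\<lambda>s.
     f_and (f_val P \<sigma>' s')
    (f_and (f_val P \<sigma> s)
    (f_and (f_abs (prefix s s'))
    (f_and (f_all (real_names P) (\<lambda>x. f_imp P (f_mem_set P x F) (f_mem_set P x F')))
           (f_all {length s..<length s'} (\<lambda>i. f_all (real_names P) (\<lambda>x. f_all UNIV (\<lambda>k.
              f_imp P (f_and (f_mem_set P x F) (f_mem P (i, k) x)) (f_abs (k \<in> s' ! i)))))))))) q1"
    unfolding f_le_Q_def by (auto elim: f_exE)
  from f_exE[OF this(3,1)] obtain q s where 2: "q \<in> conds P" "le P q q1"
    "f_val P \<sigma>' s' q" "f_val P \<sigma> s q" "prefix s s'"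
    "\<forall>x\<in>real_names P. \<forall>r\<in>conds P. le P r q \<longrightarrow> f_mem_set P x F r \<longrightarrow> f_mem_set P x F' r"
    "\<forall>i\<in>{length s..<length s'}. \<forall>x\<in>real_names P. \<forall>k. \<forall>r\<in>conds P. le P r q \<longrightarrow>
       f_mem_set P x F r \<and> f_mem P (i, k) x r \<longrightarrow> k \<in> s' ! i"
    by (simp add: forces_simps) metis
  show ?thesis
    by (rule that[OF 2(1) le_trans[OF 2(2) 1(2)] 2(3-7)])
qed

lemma f_in_Q_cond:
  assumes "normal p s xs"
  shows "f_in_Q P b h_name (check P {s}, check P (set xs)) p"
proof -
  have p: "p \<in> conds P" using assms by (simp add: normal_def)
  have "f_ex P UNIV (\<lambda>k. f_and (f_mem P (i, k) h_name) (f_abs (card (s ! i) \<le> k))) p"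
    if "i < length s" for i
    by (intro f_exI[of "h i"] persistent_intros)
      (use assms p that in \<open>auto simp: normal_def forces_simps f_mem_fun_name\<close>)
  then have "f_in_S P b h_name s p"
    using assms by (auto simp: f_in_S_def normal_def forces_simps)
  moreover have "f_card_le P (check P (set xs)) (h (length s)) p"
    unfolding f_card_le_def using assms
    by (intro f_exI[of xs] persistent_intros) (auto simp: normal_def forces_simps f_mem_set_check)
  then have "f_ex P UNIV (\<lambda>k. f_and (f_mem P (length s, k) h_name) (f_card_le P (check P (set xs)) k)) p"
    using p by (intro f_exI[of "h (length s)"] persistent_rules) (auto simp: f_and_iff f_mem_fun_name)
  moreover have "f_all (real_names P)
      (\<lambda>x. f_imp P (f_mem_set P x (check P (set xs))) (f_in_R P b x)) p"
    using assms f_in_R_if_mem_check[of "set xs" b p] by (auto simp: normal_def forces_simps)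
  ultimately show ?thesis
    unfolding f_in_Q_def using f_val_check
    by (auto intro!: f_exI[of s] persistent_rules simp: f_and_iff)
qed

lemma cond_in_conds:
  assumes "normal p s xs"
  shows "cond p s xs \<in> conds iter"
  using assms f_in_Q_cond[OF assms] unfolding cond_def iter_conds slalom_names_def normal_def
  by (auto intro!: check_in_names)

text \<open>The order demands a value of \<sigma>, which \<open>p\<close> need not decide. Being a
  condition makes such values available densely below \<open>p\<close>, and locality of
  \<open>f_le_Q\<close> brings the relation back to \<open>p\<close>.\<close>

lemma iter_refl:
  assumes "c \<in> conds iter"
  shows "le iter c c"
proof -
  obtain p \<sigma> F where c: "c = (p, \<sigma>, F)" by (cases c)
  have p: "p \<in> conds P" and Q: "f_in_Q P b h_name (\<sigma>, F) p"
    using assms by (auto simp: c iter_conds)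
  have "f_le_Q P (\<sigma>, F) (\<sigma>, F) p"
  proof (rule local_at_denseD[OF _ p])
    show "local_at_dense P (f_le_Q P (\<sigma>, F) (\<sigma>, F))"
      unfolding f_le_Q_def by (simp add: local_intros)
    fix q assume q: "q \<in> conds P" "le P q p"
    have "f_in_Q P b h_name (\<sigma>, F) q" by (rule persistentD[OF persistent_f_in_Q Q q(2)])
    then obtain r s where "r \<in> conds P" "le P r q" "f_val P \<sigma> s r"
      unfolding f_in_Q_def using q(1) by (auto elim!: f_exE simp: f_and_iff)
    then show "\<exists>r\<in>conds P. le P r q \<and> f_le_Q P (\<sigma>, F) (\<sigma>, F) r"
      using f_le_QI[of \<sigma> s r \<sigma> s F F] by auto
  qed
  then show ?thesis by (simp add: c iter_le le_refl)
qed

lemma iter_trans: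
  assumes "c3 \<in> conds iter" "le iter c3 c2" "le iter c2 c1"
  shows "le iter c3 c1"
proof -
  obtain p1 \<sigma>1 F1 p2 \<sigma>2 F2 p3 \<sigma>3 F3
    where c: "c1 = (p1, \<sigma>1, F1)" "c2 = (p2, \<sigma>2, F2)" "c3 = (p3, \<sigma>3, F3)"
    by (cases c1; cases c2; cases c3) auto
  have le: "le P p3 p2" "le P p2 p1" "f_le_Q P (\<sigma>3, F3) (\<sigma>2, F2) p3" "f_le_Q P (\<sigma>2, F2) (\<sigma>1, F1) p2"
    and p3: "p3 \<in> conds P"
    using assms by (auto simp: c iter_le iter_conds)
  have "f_le_Q P (\<sigma>3, F3) (\<sigma>1, F1) p3"
  proof (rule local_at_denseD[OF _ p3])
    show "local_at_dense P (f_le_Q P (\<sigma>3, F3) (\<sigma>1, F1))"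
      unfolding f_le_Q_def by (simp add: local_intros)
    fix q assume q: "q \<in> conds P" "le P q p3"
    obtain r s3 s2 where r: "r \<in> conds P" "le P r q" "f_val P \<sigma>3 s3 r" "f_val P \<sigma>2 s2 r" "prefix s2 s3"
      "\<forall>x\<in>real_names P. \<forall>r'\<in>conds P. le P r' r \<longrightarrow> f_mem_set P x F2 r' \<longrightarrow> f_mem_set P x F3 r'"
      "\<forall>i\<in>{length s2..<length s3}. \<forall>x\<in>real_names P. \<forall>k. \<forall>r'\<in>conds P. le P r' r \<longrightarrow>
         f_mem_set P x F2 r' \<and> f_mem P (i, k) x r' \<longrightarrow> k \<in> s3 ! i"
      by (rule f_le_QE[OF persistentD[OF persistent_f_le_Q le(3) q(2)] q(1)]) (rule that)
    have "f_le_Q P (\<sigma>2, F2) (\<sigma>1, F1) r"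
      using le(1,4) q(2) r(2) le_trans persistentD[OF persistent_f_le_Q] by blast
    then obtain u s2' s1 where u: "u \<in> conds P" "le P u r" "f_val P \<sigma>2 s2' u" "f_val P \<sigma>1 s1 u" "prefix s1 s2'"
      "\<forall>x\<in>real_names P. \<forall>r'\<in>conds P. le P r' u \<longrightarrow> f_mem_set P x F1 r' \<longrightarrow> f_mem_set P x F2 r'"
      "\<forall>i\<in>{length s1..<length s2'}. \<forall>x\<in>real_names P. \<forall>k. \<forall>r'\<in>conds P. le P r' u \<longrightarrow>
         f_mem_set P x F1 r' \<and> f_mem P (i, k) x r' \<longrightarrow> k \<in> s2' ! i"
      by (rule f_le_QE[OF _ r(1)]) (rule that)
    have val: "f_val P \<sigma>3 s3 u" "f_val P \<sigma>2 s2 u"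
      by (rule persistentD[OF persistent_f_val r(3) u(2)], rule persistentD[OF persistent_f_val r(4) u(2)])
    \<comment> \<open>Each of the two comparisons brings its own value of the middle sequence; no
      condition forces two different values.\<close>
    have [simp]: "s2' = s2" using f_val_unique[OF u(1) u(3) val(2)] .
    have "f_le_Q P (\<sigma>3, F3) (\<sigma>1, F1) u"
    proof (rule f_le_QI[OF val(1) u(4)])
      show "prefix s1 s3" using u(5) r(5) by simp
      show "f_mem_set P x F3 q" if "x \<in> real_names P" "q \<in> conds P" "le P q u" "f_mem_set P x F1 q" for x q
        using that r(6) u(6) le_trans[OF that(3) u(2)] by blast
      show "k \<in> s3 ! i" if "x \<in> real_names P" "q \<in> conds P" "le P q u" "f_mem_set P x F1 q"
        "f_mem P (i, k) x q" "length s1 \<le> i" "i < length s3" for x q i k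
      \<comment> \<open>Entries below \<open>length s2\<close> were added between the first and the
        second condition, the others between the second and the third.\<close>
      proof (cases "i < length s2")
        case True
        then have "s3 ! i = s2 ! i" using r(5) by (auto simp: prefix_def nth_append)
        then show ?thesis using u(7) that(1-6) True by auto
      next
        case False
        then show ?thesis
          using that u(6) r(7) le_trans[OF that(3) u(2)] by auto
      qed
    qed
    then show "\<exists>r\<in>conds P. le P r q \<and> f_le_Q P (\<sigma>3, F3) (\<sigma>1, F1) r"
      using u r(2) le_trans by blast
  qed
  then show ?thesis using le le_trans by (auto simp: c iter_le)
qed

lemma le_value_prefix:
  assumes "(p', \<sigma>', F') \<in> conds iter" "le iter (p', \<sigma>', F') (p, \<sigma>, F)" "f_val P \<sigma> s p" "f_val P \<sigma>' s' p'"
  shows "prefix s s'"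
proof -
  have "f_le_Q P (\<sigma>', F') (\<sigma>, F) p'" "p' \<in> conds P" and le: "le P p' p"
    using assms by (auto simp: iter_le iter_conds)
  then obtain q u' u where q: "q \<in> conds P" "le P q p'" "f_val P \<sigma>' u' q" "f_val P \<sigma> u q" "prefix u u'"
    by - (rule f_le_QE, assumption, assumption, rule that)
  then have "u = s" "u' = s'"
    using assms(3,4) le le_trans f_val_unique persistentD[OF persistent_f_val] by metis+
  then show ?thesis using q(5) by simp
qed

text \<open>The promise made by listing a real: every entry appended later captures its value. This
  is how the slalom comes to contain the codes of the pieces of a given \<open>B\<close>.\<close>

lemma le_cond_value_mem:
  assumes "le iter (cond p' s' xs') (cond p s xs)" "p' \<in> conds P"
    "fun_name P x \<in> set xs" "length s \<le> j" "j < length s'"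
  shows "x j \<in> s' ! j"
proof -
  have "f_le_Q P (check P {s'}, check P (set xs')) (check P {s}, check P (set xs)) p'"
    using assms(1) by (simp add: cond_def iter_le)
  then obtain q u' u where q: "q \<in> conds P" "f_val P (check P {s'}) u' q" "f_val P (check P {s}) u q"
    and mem: "\<forall>i\<in>{length u..<length u'}. \<forall>x\<in>real_names P. \<forall>k. \<forall>r\<in>conds P. le P r q \<longrightarrow>
       f_mem_set P x (check P (set xs)) r \<and> f_mem P (i, k) x r \<longrightarrow> k \<in> u' ! i"
    by (rule f_le_QE[OF _ assms(2)]) (rule that)
  have [simp]: "u' = s'" "u = s" using q f_val_unique f_val_check by metis+
  show ?thesis
    using mem assms(4,5) q(1) f_mem_set_checkI[OF assms(3), of q] fun_name_in_names[of P x] le_refl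
    by (auto simp: f_mem_fun_name)
qed

section \<open>Density and extension of normal conditions\<close>

lemma normal_dense:
  assumes "c \<in> conds iter"
  obtains p s xs where "normal p s xs" "le iter (cond p s xs) c"
proof -
  obtain p0 \<sigma> F where c: "c = (p0, \<sigma>, F)" by (cases c)
  have p0: "p0 \<in> conds P" and Q: "f_in_Q P b h_name (\<sigma>, F) p0"
    using assms by (auto simp: c iter_conds)
  \<comment> \<open>Three strengthenings find ground model witnesses in turn: the sequence
    \<open>s\<close>, the value \<open>k\<close> of \<open>h\<close> at its length, and a list
    \<open>xs\<close> of names exhausting \<open>F\<close>.\<close>
  from f_exE[OF Q[unfolded f_in_Q_def prod.case] p0] obtain p1 s where 1: "p1 \<in> conds P" "le P p1 p0" "f_val P \<sigma> s p1" "f_in_S P b h_name s p1"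
    "f_all (real_names P) (\<lambda>x. f_imp P (f_mem_set P x F) (f_in_R P b x)) p1"
    "f_ex P UNIV (\<lambda>k. f_and (f_mem P (length s, k) h_name) (f_card_le P F k)) p1"
    unfolding f_and_iff by blast
  from f_exE[OF 1(6,1)] obtain p2 k where 2: "p2 \<in> conds P" "le P p2 p1"
    "f_mem P (length s, k) h_name p2" "f_card_le P F k p2"
    unfolding f_and_iff by blast
  obtain p xs where 3: "p \<in> conds P" "le P p p2"
    "xs \<in> {xs. length xs \<le> k \<and> set xs \<subseteq> real_names P}"
    "f_all (real_names P) (\<lambda>x. f_iff P (f_mem_set P x F) (f_ex P (set xs) (\<lambda>y. f_eq P x y))) p"
    by (rule f_exE[OF 2(4)[unfolded f_card_le_def] 2(1)]) (rule that)
  have xs: "length xs \<le> k" "set xs \<subseteq> real_names P" using 3(3) by auto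
  have le: "le P p p1" using 2 3 le_trans by blast
  have val: "f_val P \<sigma> s p" using persistentD[OF persistent_f_val 1(3) le] .
  \<comment> \<open>Below \<open>p\<close> the name \<open>F\<close> and the canonical name of
    \<open>set xs\<close> have the same members, so exchanging them yields a stronger
    condition.\<close>
  have mem: "f_mem_set P x F q \<longleftrightarrow> f_mem_set P x (check P (set xs)) q"
    if "x \<in> real_names P" "q \<in> conds P" "le P q p" for x q
    using 3(4) that by (simp add: f_mem_set_check forces_simps)
  have "normal p s xs"
    unfolding normal_def
  proof (intro conjI allI impI ballI)
    show "length xs \<le> h (length s)" using 2 xs by (simp add: f_mem_fun_name)
    show "f_in_R P b x p" if "x \<in> set xs" for x
      using that mem[of x p] 3(1) xs(2) 1(5) le le_refl f_mem_set_checkI[OF that]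
      by (auto simp: forces_simps)
    show "s ! i \<subseteq> {..<b i}" if "i < length s" for i
      using 1(4) that by (simp add: f_in_S_def forces_simps)
    show "card (s ! i) \<le> h i" if "i < length s" for i
    proof -
      have "f_ex P UNIV (\<lambda>k. f_and (f_mem P (i, k) h_name) (f_abs (card (s ! i) \<le> k))) p1"
        using 1(4) that by (simp add: f_in_S_def forces_simps)
      then show ?thesis using 1(1) by (auto elim!: f_exE simp: forces_simps f_mem_fun_name)
    qed
  qed (use 3(1) xs in auto)
  moreover have "f_le_Q P (check P {s}, check P (set xs)) (\<sigma>, F) p"
    by (rule f_le_QI[OF f_val_check val]) (use mem in auto)
  then have "le iter (cond p s xs) c"
    using le 1(2) le_trans by (auto simp: c cond_def iter_le)
  ultimately show ?thesis using that by blast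
qed

lemma normal_strengthen:
  assumes "normal p s xs" "p' \<in> conds P" "le P p' p"
  shows "normal p' s xs" "le iter (cond p' s xs) (cond p s xs)"
proof -
  show "normal p' s xs"
    using assms persistentD[OF persistent_f_in_R] by (auto simp: normal_def)
  show "le iter (cond p' s xs) (cond p s xs)"
    using assms(3) by (auto simp: cond_def iter_le intro!: f_le_QI f_val_check)
qed

text \<open>The new entry consists of exactly the values of the listed reals at
  \<open>length s\<close>, once these are decided. It is small enough because at most
  \<open>h (length s)\<close> reals are listed, and monotonicity of \<open>h\<close> keeps the list
  admissible at the new length.\<close>

lemma normal_extend_step:
  assumes "normal p s xs"
  obtains p' v where "normal p' (s @ [v]) xs" "le iter (cond p' (s @ [v]) xs) (cond p s xs)"
proof -
  obtain q v where q: "q \<in> conds P" "le P q p"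
    "\<And>x r j. x \<in> set xs \<Longrightarrow> r \<in> conds P \<Longrightarrow> le P r q \<Longrightarrow> f_mem P (length s, j) x r \<longleftrightarrow> j = v x"
    using f_in_R_decide[of p xs b "length s" thesis] assms unfolding normal_def by blast
  have nq: "normal q s xs" using normal_strengthen[OF assms q(1,2)] by blast
  have "v x < b (length s)" if "x \<in> set xs" for x
  proof -
    have "f_mem P (length s, v x) x q" using q(1) q(3)[OF that q(1) le_refl] by simp
    moreover have "f_in_R P b x q" using nq that by (simp add: normal_def)
    ultimately show ?thesis using q(1) le_refl by (auto simp: f_in_R_def forces_simps)
  qed
  moreover have "card (v ` set xs) \<le> h (length s)"
    using nq card_image_le[of "set xs" v] card_length[of xs] by (simp add: normal_def)
  moreover have "h (length s) \<le> h (Suc (length s))" using mono_h by (simp add: monoD)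
  ultimately have "normal q (s @ [v ` set xs]) xs"
    using nq unfolding normal_def by (auto simp: nth_append less_Suc_eq)
  moreover have "f_le_Q P (check P {s @ [v ` set xs]}, check P (set xs)) (check P {s}, check P (set xs)) q"
  proof (rule f_le_QI[OF f_val_check f_val_check])
    fix x r i k assume r: "r \<in> conds P" "le P r q" "f_mem_set P x (check P (set xs)) r" "f_mem P (i, k) x r"
      and i: "length s \<le> i" "i < length (s @ [v ` set xs])"
    \<comment> \<open>An arbitrary member of the named set is equal, at some stronger condition, to
      a listed \<open>y\<close>, whose value has been decided.\<close>
    obtain r' y where r': "r' \<in> conds P" "le P r' r" "y \<in> set xs" "f_eq P x y r'"
      using r(1,3) unfolding f_mem_set_check by (auto elim: f_exE)
    have "f_mem P (i, k) y r'"
      using persistentD[OF persistent_intros(7) r(4) r'(2)] f_eqD[OF r'(4,1) le_refl] by blast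
    moreover have "i = length s" using i by simp
    ultimately have "k = v y" using q(3)[OF r'(3,1) le_trans[OF r'(2) r(2)]] by simp
    then show "k \<in> (s @ [v ` set xs]) ! i" using i r'(3) by (simp add: nth_append)
  qed auto
  ultimately show ?thesis using that q(2) by (auto simp: cond_def iter_le)
qed

lemma normal_extend:
  assumes "normal p s xs"
  obtains p' s' where "normal p' s' xs" "N \<le> length s'" "le iter (cond p' s' xs) (cond p s xs)"
proof -
  have "\<exists>p' s'. normal p' s' xs \<and> N \<le> length s' \<and> le iter (cond p' s' xs) (cond p s xs)"
  proof (induction N)
    case 0
    then show ?case using assms iter_refl[OF cond_in_conds[OF assms]] by auto
  next
    case (Suc N)
    then obtain p' s' where 1: "normal p' s' xs" "N \<le> length s'" "le iter (cond p' s' xs) (cond p s xs)"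
      by blast
    obtain p'' v where "normal p'' (s' @ [v]) xs" "le iter (cond p'' (s' @ [v]) xs) (cond p' s' xs)"
      using normal_extend_step[OF 1(1)] .
    then show ?case using 1 iter_trans[OF cond_in_conds]
      by (intro exI[of _ p''] exI[of _ "s' @ [v]"]) auto
  qed
  then show ?thesis using that by blast
qed

text \<open>The strict inequality leaves room for one more real; it can be arranged by lengthening
  \<open>s\<close> first when \<open>h\<close> tends to infinity.\<close>

lemma normal_add:
  assumes "normal p s xs" "length xs < h (length s)" "\<And>i. x i < b i"
  shows "normal p s (xs @ [fun_name P x])"
    and "le iter (cond p s (xs @ [fun_name P x])) (cond p s xs)"
proof -
  show "normal p s (xs @ [fun_name P x])"
    using assms f_in_R_fun_name[of x b p] by (auto simp: normal_def fun_name_in_names)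
  show "le iter (cond p s (xs @ [fun_name P x])) (cond p s xs)"
    unfolding cond_def iter_le
    by (auto intro!: f_le_QI f_val_check le_refl intro: f_mem_set_check_mono[rotated])
qed

end

section \<open>Separating a gap\<close>

lemma preordered_hechler: "preordered_forcing hechler"
  by unfold_locales (auto simp: hechler_def intro: order_trans prefix_order.trans)

lemma hechler_lengthen:
  assumes "(t, g) \<in> conds hechler"
  obtains t' where "(t', g) \<in> conds hechler" "le hechler (t', g) (t, g)" "N \<le> length t'"
proof
  \<comment> \<open>The stem has to agree with \<open>g\<close>, so it can only be lengthened by
    reading off values of \<open>g\<close>.\<close>
  let ?t = "map g [0..<max N (length t)]"
  have "take (length t) ?t = t"
    using assms by (intro nth_equalityI) (auto simp: hechler_def)
  then have "prefix t ?t" by (metis take_is_prefix)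
  then show "le hechler (?t, g) (t, g)" by (simp add: hechler_def)
qed (auto simp: hechler_def)

lemma submeasure_on_UN_le:
  fixes n :: nat
  assumes "submeasure_on u \<mu>" "\<And>j. j < n \<Longrightarrow> Y j \<subseteq> u"
  shows "\<mu> (\<Union>j<n. Y j) \<le> (\<Sum>j<n. \<mu> (Y j))"
  using assms(2)
proof (induction n)
  case 0
  then show ?case using assms(1) by (simp add: submeasure_on_def)
next
  case (Suc n)
  have "\<mu> ((\<Union>j<n. Y j) \<union> Y n) \<le> \<mu> (\<Union>j<n. Y j) + \<mu> (Y n)"
    using assms(1) Suc.prems by (simp add: submeasure_on_def UN_subset_iff)
  moreover have "\<mu> (\<Union>j<n. Y j) \<le> (\<Sum>j<n. \<mu> (Y j))" using Suc by simp
  ultimately show ?case by (simp add: lessThan_Suc Un_commute)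
qed

lemma finitely_many_le_nat:
  fixes f :: "nat \<Rightarrow> real"
  obtains K :: nat where "\<And>i. i < n \<Longrightarrow> f i \<le> real K"
proof -
  obtain K where "Max (f ` {..n}) \<le> real K" using real_arch_simple by blast
  then have "f i \<le> real K" if "i < n" for i
    using that by (meson Max_ge atMost_iff finite_atMost finite_imageI imageI less_imp_le order_trans)
  then show ?thesis using that by blast
qed

text \<open>The numbers below \<open>b i\<close> code the subsets of \<open>a i\<close> through
  \<open>e i\<close>. In \<open>h_slow\<close> the permitted number of sets grows with
  \<open>i\<close>, while the bound \<open>m\<close> depends on \<open>k\<close> alone.\<close>

locale countable_gap =
  fixes a :: "nat \<Rightarrow> nat set" and \<phi> :: "nat \<Rightarrow> nat set \<Rightarrow> real" and b h :: "nat \<Rightarrow> nat"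
    and e :: "nat \<Rightarrow> nat \<Rightarrow> nat set" and A :: "nat \<Rightarrow> nat set"
  assumes partition: "finite_partition a"
    and submeasure: "submeasure_on (a i) (\<phi> i)"
    and e_bij: "bij_betw (e i) {..<b i} (Pow (a i))"
    and mono_h: "mono h"
    and h_at_top: "filterlim h at_top sequentially"
    and h_slow: "\<exists>m::nat. \<forall>\<^sub>\<infinity>i. \<forall>B. B \<subseteq> Pow (a i) \<and> card B \<le> h i \<and> (\<forall>x\<in>B. \<phi> i x \<le> real k)
          \<longrightarrow> \<phi> i (\<Union>B) \<le> real m"
begin

section \<open>The name of the separating set\<close>

sublocale slalom_iteration hechler b h
  using preordered_hechler mono_h by (simp add: slalom_iteration_def slalom_iteration_axioms_def)

lemma \<phi>_mono: "x \<subseteq> y \<Longrightarrow> y \<subseteq> a i \<Longrightarrow> \<phi> i x \<le> \<phi> i y"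
  using submeasure by (simp add: submeasure_on_def)

lemma e_subset: "k < b i \<Longrightarrow> e i k \<subseteq> a i"
  using e_bij[of i] by (auto simp: bij_betw_def)

lemma a_inj: "n \<in> a i \<Longrightarrow> n \<in> a j \<Longrightarrow> i = j"
  using partition by (auto simp: finite_partition_def disjoint_family_on_def)

text \<open>With the Hechler real extending \<open>t\<close> and the generic slalom having \<open>v\<close> as its \<open>i\<close>-th entry,
  \<open>approx t v i\<close> is the part of the separating set inside \<open>a i\<close>. Testing only \<open>j \<le> i\<close> makes it
  depend on finitely many values of the Hechler real.\<close>

definition approx :: "nat list \<Rightarrow> nat set \<Rightarrow> nat \<Rightarrow> nat set" where
  "approx t v i = (\<Union>k\<in>{k\<in>v. k < b i \<and> (\<forall>j\<le>i. \<phi> i (e i k \<inter> A j) \<le> real (t ! j))}. e i k)"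

text \<open>A condition contributes only once its stem and its sequence both reach beyond
  \<open>i\<close>. From then on no extension changes \<open>approx\<close> at \<open>i\<close>, so
  the whole trace on \<open>a i\<close> is settled.\<close>

definition sep_name :: "(nat, (nat list \<times> (nat \<Rightarrow> nat)) \<times> (nat list \<times> (nat \<Rightarrow> nat)) slalom_name) name"
  where
  "sep_name = {(n, c). c \<in> conds iter \<and> (\<exists>t g \<sigma> F s i. c = ((t, g), \<sigma>, F) \<and>
     f_val hechler \<sigma> s (t, g) \<and> i < length t \<and> i < length s \<and> n \<in> a i \<and> n \<in> approx t (s ! i) i)}"

lemma normal_long_dense:
  assumes "c \<in> conds iter"
  obtains t g s xs where "normal (t, g) s xs" "N \<le> length t" "N \<le> length s"
    "le iter (cond (t, g) s xs) c"
proof -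
  obtain p0 s0 xs where 0: "normal p0 s0 xs" "le iter (cond p0 s0 xs) c"
    using normal_dense[OF assms] .
  obtain p1 s where 1: "normal p1 s xs" "N \<le> length s" "le iter (cond p1 s xs) (cond p0 s0 xs)"
    using normal_extend[OF 0(1)] .
  obtain t1 g where p1: "p1 = (t1, g)" by (cases p1)
  obtain t where t: "(t, g) \<in> conds hechler" "le hechler (t, g) (t1, g)" "N \<le> length t"
    using hechler_lengthen 1(1) unfolding normal_def p1 by blast
  note 2 = normal_strengthen[OF 1(1)[unfolded p1] t(1,2)]
  show ?thesis
    using that[OF 2(1) t(3) 1(2)] iter_trans[OF cond_in_conds[OF 2(1)]] 2(2) 1(3) 0(2) unfolding p1
    by blast
qed

lemma le_cond_prefix:
  assumes "normal (t', g') s' xs'" "le iter (cond (t', g') s' xs') ((t, g), \<sigma>, F)"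
    "f_val hechler \<sigma> s (t, g)"
  shows "prefix t t'" "prefix s s'" "g n \<le> g' n"
  using assms(2) le_value_prefix[OF cond_in_conds[OF assms(1), unfolded cond_def]
      assms(2)[unfolded cond_def] assms(3) f_val_check]
  by (auto simp: cond_def iter_le) (auto simp: hechler_def)

lemma approx_prefix:
  assumes "prefix t t'" "prefix s s'" "i < length t" "i < length s"
  shows "approx t' (s' ! i) i = approx t (s ! i) i"
proof -
  have "s' ! i = s ! i" "\<And>j. j \<le> i \<Longrightarrow> t' ! j = t ! j"
    using assms by (auto simp: prefix_def nth_append)
  then show ?thesis by (simp add: approx_def)
qed

text \<open>If membership is forced, some contributing condition \<open>d\<close> lies above a
  condition below \<open>c\<close>. A normal condition below both computes the same
  \<open>approx\<close> as each of them; disjointness of the partition ensures that they concern the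
  same \<open>i\<close>.\<close>

lemma f_mem_sep_name:
  assumes "normal (t, g) s xs" "i < length t" "i < length s" "n \<in> a i"
    and c: "c \<in> conds iter" "le iter c (cond (t, g) s xs)"
  shows "f_mem iter n sep_name c \<longleftrightarrow> n \<in> approx t (s ! i) i"
proof
  assume "f_mem iter n sep_name c"
  then obtain c1 d where c1: "c1 \<in> conds iter" "le iter c1 c" "(n, d) \<in> sep_name" "le iter c1 d"
    using c(1) iter_refl unfolding f_mem_def dense_below_def by blast
  then obtain t1 g1 \<sigma>1 F1 s1 j where d: "d = ((t1, g1), \<sigma>1, F1)" "f_val hechler \<sigma>1 s1 (t1, g1)"
    "j < length t1" "j < length s1" "n \<in> a j" "n \<in> approx t1 (s1 ! j) j"
    unfolding sep_name_def by blast
  have [simp]: "j = i" using a_inj assms(4) d(5) by blast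
  obtain t2 g2 s2 xs2 where 2: "normal (t2, g2) s2 xs2" "le iter (cond (t2, g2) s2 xs2) c1"
    using normal_long_dense[OF c1(1)] by metis
  note trans = iter_trans[OF cond_in_conds[OF 2(1)]]
  have "le iter (cond (t2, g2) s2 xs2) d" "le iter (cond (t2, g2) s2 xs2) (cond (t, g) s xs)"
    using trans 2(2) c1(2,4) c(2) by blast+
  note below = this[unfolded d(1) cond_def[of "(t, g)"]]
  have "approx t2 (s2 ! i) i = approx t1 (s1 ! i) i"
    using approx_prefix[OF le_cond_prefix(1,2)[OF 2(1) below(1) d(2)]] d(3,4) by simp
  moreover have "approx t2 (s2 ! i) i = approx t (s ! i) i"
    using approx_prefix[OF le_cond_prefix(1,2)[OF 2(1) below(2) f_val_check]] assms(2,3) by simp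
  ultimately show "n \<in> approx t (s ! i) i" using d(6) by simp
next
  assume "n \<in> approx t (s ! i) i"
  then have "(n, cond (t, g) s xs) \<in> sep_name"
    using assms(2-4) f_val_check[of s "(t, g)"] cond_in_conds[OF assms(1)]
    by (auto simp: sep_name_def cond_def)
  then show "f_mem iter n sep_name c"
    unfolding f_mem_def dense_below_def using iter_trans[OF _ _ c(2)] iter_refl by blast
qed

lemma f_not_f_mem_sep_name:
  assumes "normal (t, g) s xs" "i < length t" "i < length s" "n \<in> a i"
    and "c \<in> conds iter" "le iter c (cond (t, g) s xs)"
  shows "f_not iter (f_mem iter n sep_name) c \<longleftrightarrow> n \<notin> approx t (s ! i) i"
  unfolding f_not_def using f_mem_sep_name[OF assms(1-4)] assms(5,6) iter_trans iter_refl by blast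

text \<open>Reduces a forced statement to finite combinatorics: long normal conditions decide the
  trace of \<open>X\<close> on \<open>a i\<close>, and it remains to bound these traces uniformly
  below some stronger condition.\<close>

lemma f_in_idealI:
  assumes X: "\<And>t g s xs i n c. \<lbrakk>normal (t, g) s xs; i < length t; i < length s; n \<in> a i; c \<in> conds iter;
        le iter c (cond (t, g) s xs)\<rbrakk> \<Longrightarrow> X n c \<longleftrightarrow> n \<in> D t (s ! i) i"
    and bound: "\<And>c1. c1 \<in> conds iter \<Longrightarrow> \<exists>c2\<in>conds iter. le iter c2 c1 \<and> (\<exists>K::nat. \<forall>i t g s xs.
        normal (t, g) s xs \<longrightarrow> le iter (cond (t, g) s xs) c2 \<longrightarrow> i < length t \<longrightarrow> i < length s \<longrightarrow>
        \<phi> i (D t (s ! i) i \<inter> a i) \<le> real K)"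
  shows "f_in_ideal iter a \<phi> X c"
  unfolding f_in_ideal_def f_ex_def dense_below_def
proof (intro ballI impI)
  fix c1 assume "c1 \<in> conds iter"
  then obtain c2 K where c2: "c2 \<in> conds iter" "le iter c2 c1"
    "\<And>i t g s xs. \<lbrakk>normal (t, g) s xs; le iter (cond (t, g) s xs) c2; i < length t; i < length s\<rbrakk> \<Longrightarrow>
        \<phi> i (D t (s ! i) i \<inter> a i) \<le> real (K::nat)"
    using bound[of c1] by blast
  have "\<exists>r\<in>conds iter. le iter r c3 \<and> (\<exists>y\<in>Pow (a i).
      f_and (f_all (a i) (\<lambda>n. f_iff iter (X n) (f_abs (n \<in> y)))) (f_abs (\<phi> i y \<le> real K)) r)"
    if c3: "c3 \<in> conds iter" "le iter c3 c2" for c3 i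
  proof -
    obtain t g s xs where 4: "normal (t, g) s xs" "Suc i \<le> length t" "Suc i \<le> length s"
      "le iter (cond (t, g) s xs) c3"
      using normal_long_dense[OF c3(1)] .
    have "\<phi> i (D t (s ! i) i \<inter> a i) \<le> real K"
      using c2(3)[OF 4(1) iter_trans[OF cond_in_conds[OF 4(1)] 4(4) c3(2)]] 4(2,3) by simp
    then show ?thesis
      using 4 X[OF 4(1)] cond_in_conds[OF 4(1)]
      by (intro bexI[of _ "cond (t, g) s xs"] conjI bexI[of _ "D t (s ! i) i \<inter> a i"])
        (auto simp: forces_simps)
  qed
  then show "\<exists>r\<in>conds iter. le iter r c1 \<and> r \<in> {q. \<exists>K\<in>UNIV. f_all UNIV (\<lambda>i p. \<forall>q\<in>conds iter.
      le iter q p \<longrightarrow> (\<exists>r\<in>conds iter. le iter r q \<and> r \<in> {q. \<exists>y\<in>Pow (a i).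
        f_and (f_all (a i) (\<lambda>n. f_iff iter (X n) (f_abs (n \<in> y)))) (f_abs (\<phi> i y \<le> real K)) q})) q}"
    using c2(1,2) unfolding f_all_iff mem_Collect_eq by blast
qed

section \<open>The two halves of separation\<close>

lemma inter_in_ideal:
  "f_in_ideal iter a \<phi> (\<lambda>n. f_and (f_abs (n \<in> A l)) (f_mem iter n sep_name)) c"
proof (rule f_in_idealI[where D = "\<lambda>t v i. A l \<inter> approx t v i"])
  fix c1 assume c1: "c1 \<in> conds iter"
  obtain t0 g0 s0 xs0 where 0: "normal (t0, g0) s0 xs0" "Suc l \<le> length t0"
    "le iter (cond (t0, g0) s0 xs0) c1"
    using normal_long_dense[OF c1] by metis
  \<comment> \<open>The stem \<open>t0\<close> is longer than \<open>l\<close>, so the Hechler real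
    has the fixed value \<open>t0 ! l\<close> there, which serves as the \<open>k\<close> of
    \<open>h_slow\<close>.\<close>
  obtain m N where m: "\<And>i B. \<lbrakk>N \<le> i; B \<subseteq> Pow (a i); card B \<le> h i; \<forall>x\<in>B. \<phi> i x \<le> real (t0 ! l)\<rbrakk>
      \<Longrightarrow> \<phi> i (\<Union>B) \<le> real m"
    using h_slow[of "t0 ! l"] unfolding MOST_nat_le by metis
  \<comment> \<open>Finitely many \<open>i\<close> are bounded crudely: those before the threshold
    \<open>N\<close>, and those below \<open>l\<close>, where the test does not yet involve
    \<open>A l\<close>.\<close>
  obtain K where K: "\<And>i. i < max N l \<Longrightarrow> \<phi> i (a i) \<le> real K"
    using finitely_many_le_nat[of "max N l" "\<lambda>i. \<phi> i (a i)"] by blast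
  have "\<phi> i (A l \<inter> approx t (s ! i) i \<inter> a i) \<le> real (max m K)"
    if n: "normal (t, g) s xs" "le iter (cond (t, g) s xs) (cond (t0, g0) s0 xs0)"
      "i < length t" "i < length s" for i t g s xs
  proof (cases "i < max N l")
    case True
    have "\<phi> i (A l \<inter> approx t (s ! i) i \<inter> a i) \<le> \<phi> i (a i)" by (rule \<phi>_mono) auto
    then show ?thesis using K[OF True] by simp
  next
    case False
    define I where "I = {k \<in> s ! i. k < b i \<and> (\<forall>j\<le>i. \<phi> i (e i k \<inter> A j) \<le> real (t ! j))}"
    have t: "t ! l = t0 ! l"
      using le_cond_prefix(1)[OF n(1) n(2)[unfolded cond_def[of "(t0, g0)"]] f_val_check] 0(2)
      by (auto simp: prefix_def nth_append)
    have si: "s ! i \<subseteq> {..<b i}" "card (s ! i) \<le> h i" using n(1,4) by (auto simp: normal_def)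
    then have "finite (s ! i)" using finite_subset by blast
    then have "card ((\<lambda>k. e i k \<inter> A l) ` I) \<le> card (s ! i)"
      unfolding I_def by (intro surj_card_le[of _ _ "\<lambda>k. e i k \<inter> A l"]) auto
    then have "\<phi> i (\<Union> ((\<lambda>k. e i k \<inter> A l) ` I)) \<le> real m"
      using False si(2) e_subset by (intro m) (auto simp: I_def simp flip: t)
    moreover have "A l \<inter> approx t (s ! i) i \<inter> a i = \<Union> ((\<lambda>k. e i k \<inter> A l) ` I)"
      using e_subset[of _ i] by (auto simp: approx_def I_def)
    ultimately show ?thesis by simp
  qed
  then show "\<exists>c2\<in>conds iter. le iter c2 c1 \<and> (\<exists>K::nat. \<forall>i t g s xs.
        normal (t, g) s xs \<longrightarrow> le iter (cond (t, g) s xs) c2 \<longrightarrow> i < length t \<longrightarrow> i < length s \<longrightarrow>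
        \<phi> i (A l \<inter> approx t (s ! i) i \<inter> a i) \<le> real K)"
    using cond_in_conds[OF 0(1)] 0(3) by blast
qed (auto simp: forces_simps f_mem_sep_name)

lemma diff_in_ideal:
  assumes "\<And>j. A j \<inter> B \<in> frag_ideal a \<phi>"
  shows "f_in_ideal iter a \<phi> (\<lambda>n. f_and (f_abs (n \<in> B)) (f_not iter (f_mem iter n sep_name))) c"
proof (rule f_in_idealI[where D = "\<lambda>t v i. B - approx t v i"])
  fix c1 assume c1: "c1 \<in> conds iter"
  \<comment> \<open>Orthogonality yields for each \<open>j\<close> a bound uniform in
    \<open>i\<close>; these bounds form the function \<open>f\<close> that the Hechler real is to
    dominate.\<close>
  have "\<exists>k::nat. \<forall>i. \<phi> i (A j \<inter> B \<inter> a i) \<le> real k" for j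
  proof -
    obtain M where M: "\<And>i. \<phi> i (A j \<inter> B \<inter> a i) \<le> M"
      using assms[of j] by (auto simp: frag_ideal_def bdd_above_def)
    obtain k :: nat where "M \<le> real k" using real_arch_simple by blast
    then show ?thesis using M order_trans by blast
  qed
  then obtain f where f: "\<And>i j. \<phi> i (A j \<inter> B \<inter> a i) \<le> real (f j :: nat)" by metis
  obtain p0 s0 xs where 0: "normal p0 s0 xs" "le iter (cond p0 s0 xs) c1"
    using normal_dense[OF c1] .
  \<comment> \<open>Lengthening \<open>s\<close> to at least \<open>N\<close> makes room for one
    further real.\<close>
  obtain N where N: "Suc (length xs) \<le> h N"
    using h_at_top unfolding filterlim_at_top eventually_sequentially by blast
  obtain p s where 1: "normal p s xs" "N \<le> length s" "le iter (cond p s xs) (cond p0 s0 xs)"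
    using normal_extend[OF 0(1)] .
  have "h N \<le> h (length s)" using mono_h 1(2) by (rule monoD)
  then have slack: "length xs < h (length s)" using N by simp
  obtain t g where p: "p = (t, g)" by (cases p)
  \<comment> \<open>Values on the stem must stay as they are; beyond it \<open>g'\<close> is raised
    above \<open>f\<close>.\<close>
  define g' where "g' j = (if j < length t then g j else max (g j) (f j))" for j
  have "(t, g) \<in> conds hechler" using 1(1) by (simp add: normal_def p)
  then have "(t, g') \<in> conds hechler" "le hechler (t, g') (t, g)"
    by (auto simp: hechler_def g'_def)
  note 2 = normal_strengthen[OF 1(1)[unfolded p] this]
  \<comment> \<open>On the stem the Hechler real may lie below \<open>f\<close>, so the
    corresponding sets \<open>A j\<close> are removed; the pieces of \<open>B'\<close> then pass the
    test there with value 0.\<close>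
  define B' where "B' = B - (\<Union>j<length t. A j)"
  have "\<exists>k<b i. e i k = B' \<inter> a i" for i
    using e_bij[of i] unfolding bij_betw_def by (metis Int_lower2 PowI imageE lessThan_iff)
  then obtain x where x: "\<And>i. x i < b i" "\<And>i. e i (x i) = B' \<inter> a i" by metis
  define ys where "ys = xs @ [fun_name hechler x]"
  note 3 = normal_add[OF 2(1) slack x(1), folded ys_def]
  \<comment> \<open>Entries of \<open>s\<close> were fixed before \<open>x\<close> was listed and
    may miss its values.\<close>
  obtain K where K: "\<And>i. i < length s \<Longrightarrow> \<phi> i (a i) \<le> real K"
    using finitely_many_le_nat[of "length s" "\<lambda>i. \<phi> i (a i)"] by blast
  have "\<phi> i ((B - approx t1 (s1 ! i) i) \<inter> a i) \<le> real (max K (\<Sum>j<length t. f j))"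
    if n: "normal (t1, g1) s1 xs1" "le iter (cond (t1, g1) s1 xs1) (cond (t, g') s ys)"
      "i < length t1" "i < length s1" for i t1 g1 s1 xs1
  proof (cases "i < length s")
    case True
    have "\<phi> i ((B - approx t1 (s1 ! i) i) \<inter> a i) \<le> \<phi> i (a i)" by (rule \<phi>_mono) auto
    then show ?thesis using K[OF True] by simp
  next
    case False
    have cond1: "(t1, g1) \<in> conds hechler" using n(1) by (simp add: normal_def)
    have "x i \<in> s1 ! i"
      using False n(4) by (intro le_cond_value_mem[OF n(2) cond1]) (auto simp: ys_def)
    moreover have "\<phi> i (e i (x i) \<inter> A j) \<le> real (t1 ! j)" if "j \<le> i" for j
    proof (cases "j < length t")
      case True
      then have "e i (x i) \<inter> A j = {}" by (auto simp: x B'_def)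
      then show ?thesis using submeasure[of i] by (simp add: submeasure_on_def)
    next
      case False
      have "\<phi> i (e i (x i) \<inter> A j) \<le> \<phi> i (A j \<inter> B \<inter> a i)"
        by (rule \<phi>_mono) (auto simp: x B'_def)
      also have "\<dots> \<le> real (f j)" by (rule f)
      also have "f j \<le> g' j" using False by (simp add: g'_def)
      also have "g' j \<le> g1 j"
        using le_cond_prefix(3)[OF n(1) n(2)[unfolded cond_def[of "(t, g')"]] f_val_check] .
      also have "g1 j = t1 ! j" using cond1 that n(3) by (simp add: hechler_def)
      finally show ?thesis by simp
    qed
    ultimately have "e i (x i) \<subseteq> approx t1 (s1 ! i) i"
      using x(1) by (auto simp: approx_def)
    \<comment> \<open>As \<open>B'\<close> is covered on \<open>a i\<close>, what remains of
      \<open>B\<close> lies in the removed sets, each of which meets \<open>B\<close> in a set of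
      the ideal.\<close>
    then have "(B - approx t1 (s1 ! i) i) \<inter> a i \<subseteq> (\<Union>j<length t. A j \<inter> B \<inter> a i)"
      by (auto simp: x B'_def)
    then have "\<phi> i ((B - approx t1 (s1 ! i) i) \<inter> a i) \<le> \<phi> i (\<Union>j<length t. A j \<inter> B \<inter> a i)"
      by (rule \<phi>_mono) auto
    also have "\<dots> \<le> (\<Sum>j<length t. \<phi> i (A j \<inter> B \<inter> a i))"
      by (rule submeasure_on_UN_le[OF submeasure]) auto
    also have "\<dots> \<le> (\<Sum>j<length t. real (f j))" by (intro sum_mono f)
    also have "\<dots> = real (\<Sum>j<length t. f j)" by simp
    finally show ?thesis by linarith
  qed
  moreover have "le iter (cond (t, g') s ys) c1"
    using iter_trans[OF cond_in_conds[OF 3(1)]] 3(2) 2(2) 1(3) 0(2) unfolding p by blast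
  ultimately show "\<exists>c2\<in>conds iter. le iter c2 c1 \<and> (\<exists>K::nat. \<forall>i t g s xs.
        normal (t, g) s xs \<longrightarrow> le iter (cond (t, g) s xs) c2 \<longrightarrow> i < length t \<longrightarrow> i < length s \<longrightarrow>
        \<phi> i ((B - approx t (s ! i) i) \<inter> a i) \<le> real K)"
    using cond_in_conds[OF 3(1)] by blast
qed (auto simp: forces_simps f_not_f_mem_sep_name)

lemma separation_forced:
  assumes "\<A> \<subseteq> range A" "\<And>j B. B \<in> \<B> \<Longrightarrow> A j \<inter> B \<in> frag_ideal a \<phi>"
  shows "forced iter (f_ex iter (names iter UNIV) (\<lambda>C. f_separates iter a \<phi> \<A> \<B> C))"
proof -
  have "f_separates iter a \<phi> \<A> \<B> sep_name c" for c
    unfolding f_separates_def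
  proof (rule f_andI; rule f_allI)
    fix X assume "X \<in> \<A>"
    then obtain l where "X = A l" using assms(1) by blast
    then show "f_in_ideal iter a \<phi> (\<lambda>n. f_and (f_abs (n \<in> X)) (f_mem iter n sep_name)) c"
      by (simp add: inter_in_ideal)
  qed (use assms(2) in \<open>blast intro: diff_in_ideal\<close>)
  moreover have "sep_name \<in> names iter UNIV" by (auto simp: names_def sep_name_def)
  ultimately show ?thesis
    using iter_refl unfolding forced_def f_ex_def dense_below_def by blast
qed

end

section \<open>A slowly growing width for the slaloms\<close>

lemma slow_function:
  fixes T :: "nat \<Rightarrow> nat"
  obtains h where "mono h" "filterlim h at_top sequentially" "\<And>i. 0 < h i \<Longrightarrow> T (h i) \<le> i"
proof -
  define L where "L i = {l. l \<le> i \<and> (\<forall>l'\<in>{1..l}. T l' \<le> i)}" for i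
  define h where "h i = Max (L i)" for i
  have fin: "finite (L i)" and ne: "L i \<noteq> {}" for i
    by (auto simp: L_def intro: finite_subset[of _ "{..i}"] exI[of _ 0])
  have "h i \<in> L i" for i unfolding h_def using fin ne by (rule Max_in)
  then have "T (h i) \<le> i" if "0 < h i" for i using that by (auto simp: L_def)
  moreover have "mono h"
  proof
    fix i j :: nat assume "i \<le> j"
    then have "L i \<subseteq> L j" by (fastforce simp: L_def)
    then show "h i \<le> h j" unfolding h_def by (rule Max_mono[OF _ ne fin])
  qed
  moreover have "filterlim h at_top sequentially"
    unfolding filterlim_at_top eventually_sequentially
  proof (intro allI exI impI)
    \<comment> \<open>The sum dominates each \<open>T l\<close> with \<open>l \<le> N\<close>, and
      the summand \<open>N\<close> takes care of the cap.\<close>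
    fix N i assume i: "N + (\<Sum>l\<le>N. T l) \<le> i"
    have "T l \<le> i" if "l \<le> N" for l
      using i member_le_sum[of l "{..N}" T] that by simp
    then have "N \<in> L i" using i by (auto simp: L_def)
    then show "N \<le> h i" unfolding h_def using fin by simp
  qed
  ultimately show ?thesis using that by blast
qed

text \<open>A threshold \<open>i0 k l\<close> works for one \<open>k\<close> and one
  \<open>l\<close>, but a single \<open>h\<close> has to serve all \<open>k\<close>. Summing the
  thresholds over \<open>k \<le> l\<close> handles each \<open>k\<close> as soon as
  \<open>h i\<close> has reached it.\<close>

lemma gradually_fragmented_slow:
  assumes "gradually_fragmented a \<phi>"
  obtains h where "mono h" "filterlim h at_top sequentially"
    "\<And>k. \<exists>m::nat. \<forall>\<^sub>\<infinity>i. \<forall>B. B \<subseteq> Pow (a i) \<and> card B \<le> h i \<and> (\<forall>x\<in>B. \<phi> i x \<le> real k)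
          \<longrightarrow> \<phi> i (\<Union>B) \<le> real m"
proof -
  obtain m i0 where m: "\<And>k l i B. \<lbrakk>i0 k l \<le> i; B \<subseteq> Pow (a i); card B \<le> l; \<forall>x\<in>B. \<phi> i x \<le> real k\<rbrakk>
      \<Longrightarrow> \<phi> i (\<Union>B) \<le> real (m k :: nat)"
    using assms unfolding gradually_fragmented_def MOST_nat_le by metis
  obtain h where h: "mono h" "filterlim h at_top sequentially"
    "\<And>i. 0 < h i \<Longrightarrow> (\<Sum>k\<le>h i. i0 k (h i)) \<le> i"
    using slow_function[of "\<lambda>l. \<Sum>k\<le>l. i0 k l"] by blast
  have "\<exists>m::nat. \<forall>\<^sub>\<infinity>i. \<forall>B. B \<subseteq> Pow (a i) \<and> card B \<le> h i \<and> (\<forall>x\<in>B. \<phi> i x \<le> real k)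
          \<longrightarrow> \<phi> i (\<Union>B) \<le> real m" for k
  proof -
    \<comment> \<open>\<open>Suc k\<close> gives both \<open>0 < h i\<close> and
      \<open>k \<le> h i\<close>.\<close>
    obtain N where N: "\<And>i. N \<le> i \<Longrightarrow> Suc k \<le> h i"
      using h(2) unfolding filterlim_at_top eventually_sequentially by blast
    have "i0 k (h i) \<le> i" if "N \<le> i" for i
      using N[OF that] h(3)[of i] member_le_sum[of k "{..h i}" "\<lambda>k. i0 k (h i)"] by simp
    then show ?thesis unfolding MOST_nat_le using m by blast
  qed
  then show ?thesis using that h by blast
qed

theorem theorem4p3:
  fixes a :: "nat \<Rightarrow> nat set" and \<phi> :: "nat \<Rightarrow> nat set \<Rightarrow> real"
  assumes "finite_partition a"
    and "\<And>i. submeasure_on (a i) (\<phi> i)"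
    and "gradually_fragmented a \<phi>"
  shows "\<exists>b :: nat \<Rightarrow> nat. (\<forall>i. b i > 0) \<and>
    (\<exists>h \<in> real_names hechler.
       forced hechler
         (f_and (f_fun hechler h) (f_and (f_nondecreasing hechler h) (f_to_infinity hechler h))) \<and>
       (\<forall>\<A> \<B>. orthogonal_wrt (frag_ideal a \<phi>) \<A> \<B> \<and> countable \<A> \<longrightarrow>
          forced (hechler_slalom b h)
            (f_ex (hechler_slalom b h) (names (hechler_slalom b h) UNIV)
               (\<lambda>C. f_separates (hechler_slalom b h) a \<phi> \<A> \<B> C))))"
proof -
  define b where "b i = card (Pow (a i))" for i
  have fin: "finite (a i)" for i using assms(1) by (simp add: finite_partition_def)
  have b_pos: "b i > 0" for i using fin by (auto simp: b_def card_gt_0_iff)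
  have "\<exists>e. bij_betw e {..<b i} (Pow (a i))" for i
    using ex_bij_betw_nat_finite[of "Pow (a i)"] fin by (simp add: b_def atLeast0LessThan)
  then obtain e where e: "\<And>i. bij_betw (e i) {..<b i} (Pow (a i))" by metis
  obtain h where h: "mono h" "filterlim h at_top sequentially"
    "\<And>k. \<exists>m::nat. \<forall>\<^sub>\<infinity>i. \<forall>B. B \<subseteq> Pow (a i) \<and> card B \<le> h i \<and> (\<forall>x\<in>B. \<phi> i x \<le> real k)
          \<longrightarrow> \<phi> i (\<Union>B) \<le> real m"
    using gradually_fragmented_slow[OF assms(3)] by blast
  \<comment> \<open>Established before the pair is given, so the same \<open>b\<close> and
    \<open>h\<close> serve every enumeration \<open>A\<close>.\<close>
  have gap: "countable_gap a \<phi> b h e" by unfold_locales (use assms e h in auto)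
  interpret slalom_iteration hechler b h
    using preordered_hechler h(1) by (simp add: slalom_iteration_def slalom_iteration_axioms_def)
  show ?thesis
  proof (intro exI[of _ b] conjI allI bexI[of _ "fun_name hechler h"] impI)
    fix \<A> \<B> assume AB: "orthogonal_wrt (frag_ideal a \<phi>) \<A> \<B> \<and> countable \<A>"
    \<comment> \<open>Adding the empty set makes an enumeration possible even for empty \<A>; its
      traces on members of \<B> are empty and so belong to the ideal.\<close>
    define A where "A = from_nat_into (insert {} \<A>)"
    have range: "range A = insert {} \<A>"
      unfolding A_def using AB by (intro range_from_nat_into) auto
    have "{} \<in> frag_ideal a \<phi>"
      using assms(2) by (simp add: frag_ideal_def submeasure_on_def)
    then have orth: "A j \<inter> B \<in> frag_ideal a \<phi>" if "B \<in> \<B>" for j B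
      using AB that range rangeI[of A j] by (auto simp: orthogonal_wrt_def)
    show "forced (hechler_slalom b (fun_name hechler h))
      (f_ex (hechler_slalom b (fun_name hechler h)) (names (hechler_slalom b (fun_name hechler h)) UNIV)
        (\<lambda>C. f_separates (hechler_slalom b (fun_name hechler h)) a \<phi> \<A> \<B> C))"
      using countable_gap.separation_forced[OF gap, of \<A> A \<B>] range orth by (auto simp: iter_def)
  qed (use b_pos h_name_forced[OF h(2)] fun_name_in_names in auto)
qed

end
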